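(* Let $m\ge4$ and $n\ge0$ be integers, let $d_n=\left\lfloor\frac{2n+2}{3}\right\rfloor$, and let $X^m_n$ be the cell complex, homotopy equivalent to $\mathrm{Ind}(\Delta^m_n)$, produced by the Comb Algorithm. If $n=3k$ or $n=3k+1$ for some integer $k$, then $\widetilde H_{d_n}(X^m_n;\mathbb{Z})\cong\mathbb{Z}$. If $n=3k+2$ for some integer $k$, then $\widetilde H_{d_n}(X^m_n;\mathbb{Z})$ is trivial. Here $\widetilde H_*$ denotes reduced homology.
   Context: All graphs are finite and simple; $N(p)$ is the set of neighbors of $p$. $\mathrm{Ind}(G)$ is the independence complex of $G$: the simplicial complex on $V(G)$ whose faces are the independent sets of $G$ (including $\emptyset$); a face with $r$ vertices has dimension $r-1$. $Pa_\ell$ is the path on $\ell$ vertices; $\biguplus$ is disjoint union. Graphs. For $m\ge1,n\ge 1$, $Y^m_n$ is the extended star: a central vertex of degree $m$ with $m$ paths ("tendrils") of $n$ edges each emanating from it; $Y^m_0$ is a single vertex. $\widehat Y^m_n$ consists of two vertices $a,b$ joined by $m$ internally disjoint paths with $n+1$ edges each; the $k$-th vertex away from $a$ on the $j$-th path is $(j,k)$. For $n\ge 1$, $\Delta^m_n$ is $\widehat Y^m_{n+1}$ with $n$ additional vertices $1,\dots,n$ and additional edges $\{k,(j,k)\}$, $\{k,(j,k+1)\}$ for $j\in\{1,\dots,m\}$, $k\in\{1,\dots,n\}$. Also $\Delta^m_0:=\widehat Y^m_1$ and $\Delta^m_{-1}$ is a single vertex. Matching trees. For disjoint $A,B\subseteq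 V(G)$ let $\Sigma(A,B)=\{I\in\mathrm{Ind}(G): A\subseteq I,\ B\cap I=\emptyset\}$. A matching tree starts with the root $\Sigma(\emptyset,\emptyset)$; as long as some leaf $\Sigma(A,B)$ has at least two elements, perform one of: (1) if some $p\in V\setminus(A\cup B)$ has $N(p)\setminus(A\cup B)=\emptyset$, give the leaf one child labeled $\emptyset$ ($p$ is a free vertex); (2) if some $p\in V\setminus(A\cup B)$ has $N(p)\setminus(A\cup B)=\{v\}$, give the leaf one child $\Sigma(A\cup\{v\},B\cup N(v))$; (3) choose $v\in V\setminus(A\cup B)$ and give the leaf two children $\Sigma(A,B\cup\{v\})$ and $\Sigma(A\cup\{v\},B\cup N(v))$. The available graph at a node is the subgraph induced on $V\setminus(A\cup B)$. The critical cells are the faces $A$ for the nonempty final leaves $\Sigma(A,B)$. By discrete Morse theory, $\mathrm{Ind}(G)$ is homotopy equivalent to a cell complex with one $d$-cell for each $d$-dimensional critical cell, plus one extra $0$-cell (the base $0$-cell, present since $\emptyset$ is matched). Trees for auxiliary graphs. Path: repeatedly apply (2) with $p$ an end vertex and $v$ its neighbor, and (1) if an isolated vertex remains. $Y^m_n$ with $n\equiv 0 \bmod 3$: on each tendril in turn apply (2) starting from its leaf ($p$ the leaf, $v$ its neighbor, and so on) until the tendril is exhausted, then apply (1) to the central vertex. $Y^m_n$ with $n\not\equiv0\bmod 3$: apply (3) with $v$ the central vertex, then the path trees to the remaining disjoint paths. $\widehat Y^m_n$: apply (3) with $v=b$; the available graphs are then $Y^m_{n-1}$ and $Y^m_n$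 (centered at $a$), to which the previous trees are applied. Comb Algorithm for $\mathrm{Ind}(\Delta^m_n)$ ($m\ge2$, $n\ge1$): for $k=1,\dots,n$ successively apply (3) with $v=k$ at $\Sigma(\emptyset,\{1,\dots,k-1\})$. Then: at $\Sigma(\{1\},N(1))$ apply (1) with $p=a$; at $\Sigma(\{k\},N(k)\cup\{1,\dots,k-1\})$ for $2\le k\le n-1$, the available graph is $Y^m_{k-1}\biguplus\Delta^m_{n-(k+1)}$, and one applies the tree of $Y^m_{k-1}$ and then, below any nonempty leaf, recursively the Comb Algorithm for $\Delta^m_{n-(k+1)}$ (the tree of $\widehat Y^m_1$ if $n-(k+1)=0$); at $\Sigma(\{n\},N(n)\cup\{1,\dots,n-1\})$ apply (1) with $p=b$; at $\Sigma(\emptyset,\{1,\dots,n\})$ the available graph is $\widehat Y^m_{n+1}$ and one applies its tree. $X^m_n$ ($n\ge1$) is the resulting cell complex, homotopy equivalent to $\mathrm{Ind}(\Delta^m_n)$; $X^m_0:=S^0$ (two $0$-cells). *)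

theory Defs
  imports "HOL-Homology.Homology"
begin

section \<open>Graphs and independence complexes\<close>

text \<open>Edges are two-element sets of vertices.\<close>

record 'v graph =
  verts :: "'v set"
  edges :: "'v set set"

definition nbrs :: "'v graph \<Rightarrow> 'v \<Rightarrow> 'v set" where
  "nbrs G p = {q \<in> verts G. {p, q} \<in> edges G}"

definition Ind :: "'v graph \<Rightarrow> 'v set set" where
  "Ind G = {I. I \<subseteq> verts G \<and> (\<forall>e\<in>edges G. \<not> e \<subseteq> I)}"

text \<open>
  The geometric realization of a finite abstract simplicial complex \<open>K\<close>, in barycentric
  coordinates. The empty face contributes no point, as its coordinates would sum to 0.
\<close>

definition realization :: "'v set set \<Rightarrow> ('v \<Rightarrow> real) topology" where
  "realization K = subtopology (powertop_real UNIV)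
     {x. (\<forall>v. 0 \<le> x v) \<and> {v. x v \<noteq> 0} \<in> K \<and> (\<Sum>v | x v \<noteq> 0. x v) = 1}"


section \<open>The graphs \<open>\<Delta>\<^sup>m\<^sub>n\<close>\<close>

text \<open>
  \<open>PathV j k\<close> is the vertex \<open>(j,k)\<close>, and \<open>Extra k\<close> is the additional vertex \<open>k\<close> of
  \<open>\<Delta>\<^sup>m\<^sub>n\<close>.
\<close>

datatype vertex = EndA | EndB | PathV nat nat | Extra nat

text \<open>Only meaningful for \<open>n \<ge> 1\<close>, since \<open>n = 0\<close> would need \<open>m\<close> parallel edges.\<close>

definition Yhat :: "nat \<Rightarrow> nat \<Rightarrow> vertex graph" where
  "Yhat m n = \<lparr>
     verts = {EndA, EndB} \<union> {PathV j k | j k. j \<in> {1..m} \<and> k \<in> {1..n}},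
     edges = {{EndA, PathV j 1} | j. j \<in> {1..m}}
           \<union> {{PathV j k, PathV j (k + 1)} | j k. j \<in> {1..m} \<and> k \<in> {1..<n}}
           \<union> {{PathV j n, EndB} | j. j \<in> {1..m}}\<rparr>"

definition Delta :: "nat \<Rightarrow> nat \<Rightarrow> vertex graph" where
  "Delta m n = \<lparr>
     verts = verts (Yhat m (n + 1)) \<union> Extra ` {1..n},
     edges = edges (Yhat m (n + 1))
           \<union> {{Extra k, PathV j k} | j k. j \<in> {1..m} \<and> k \<in> {1..n}}
           \<union> {{Extra k, PathV j (k + 1)} | j k. j \<in> {1..m} \<and> k \<in> {1..n}}\<rparr>"


section \<open>Matching trees\<close>

definition Sigma_node :: "'v graph \<Rightarrow> 'v set \<Rightarrow> 'v set \<Rightarrow> 'v set set" where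
  "Sigma_node G A B = {I \<in> Ind G. A \<subseteq> I \<and> B \<inter> I = {}}"

text \<open>
  A tree records the step performed at each node; the labels \<open>\<Sigma>(A,B)\<close> are recovered from
  the root. \<open>Free p\<close> is step (1), whose only child is \<open>\<emptyset>\<close>; \<open>Forced p v t\<close> is step (2);
  in \<open>Split v t u\<close>, step (3), the branch \<open>t\<close> leaves \<open>v\<close> out and the branch \<open>u\<close> takes \<open>v\<close> in.
\<close>

datatype 'v mtree =
    Final
  | Free 'v
  | Forced 'v 'v "'v mtree"
  | Split 'v "'v mtree" "'v mtree"

fun matching_tree :: "'v graph \<Rightarrow> 'v set \<Rightarrow> 'v set \<Rightarrow> 'v mtree \<Rightarrow> bool" where
  "matching_tree G A B Final \<longleftrightarrow> card (Sigma_node G A B) \<le> 1"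
| "matching_tree G A B (Free p) \<longleftrightarrow> card (Sigma_node G A B) \<ge> 2 \<and>
     p \<in> verts G - (A \<union> B) \<and> nbrs G p - (A \<union> B) = {}"
| "matching_tree G A B (Forced p v t) \<longleftrightarrow> card (Sigma_node G A B) \<ge> 2 \<and>
     p \<in> verts G - (A \<union> B) \<and> nbrs G p - (A \<union> B) = {v} \<and>
     matching_tree G (A \<union> {v}) (B \<union> nbrs G v) t"
| "matching_tree G A B (Split v t u) \<longleftrightarrow> card (Sigma_node G A B) \<ge> 2 \<and>
     v \<in> verts G - (A \<union> B) \<and>
     matching_tree G A (B \<union> {v}) t \<and> matching_tree G (A \<union> {v}) (B \<union> nbrs G v) u"

fun critical_cells :: "'v graph \<Rightarrow> 'v set \<Rightarrow> 'v set \<Rightarrow> 'v mtree \<Rightarrow> 'v set set" where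
  "critical_cells G A B Final = (if Sigma_node G A B = {} then {} else {A})"
| "critical_cells G A B (Free p) = {}"
| "critical_cells G A B (Forced p v t) = critical_cells G (A \<union> {v}) (B \<union> nbrs G v) t"
| "critical_cells G A B (Split v t u) =
     critical_cells G A (B \<union> {v}) t \<union> critical_cells G (A \<union> {v}) (B \<union> nbrs G v) u"


section \<open>The cell complex of a matching tree\<close>

definition disc :: "nat \<Rightarrow> (nat \<Rightarrow> real) set" where
  "disc d = {x. (\<forall>i\<ge>d. x i = 0) \<and> (\<Sum>i<d. (x i)\<^sup>2) \<le> 1}"

definition open_disc :: "nat \<Rightarrow> (nat \<Rightarrow> real) set" where
  "open_disc d = {x. (\<forall>i\<ge>d. x i = 0) \<and> (\<Sum>i<d. (x i)\<^sup>2) < 1}"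

text \<open>
  \<open>cell_structure X C d \<Phi>\<close>: the maps \<open>\<Phi> c\<close> are the characteristic maps of a finite CW structure
  on \<open>X\<close> with one cell of dimension \<open>d c\<close> for each \<open>c \<in> C\<close>. As \<open>C\<close> is finite and \<open>X\<close> is
  Hausdorff, \<open>X\<close> automatically carries the weak topology, and each \<open>\<Phi> c\<close> is automatically a
  homeomorphism from the open disc onto its open cell.
\<close>

definition cell_structure ::
    "'a topology \<Rightarrow> 'c set \<Rightarrow> ('c \<Rightarrow> nat) \<Rightarrow> ('c \<Rightarrow> (nat \<Rightarrow> real) \<Rightarrow> 'a) \<Rightarrow> bool" where
  "cell_structure X C d \<Phi> \<longleftrightarrow>
     finite C \<and> Hausdorff_space X \<and>
     (\<forall>c\<in>C. continuous_map (subtopology (Euclidean_space (d c)) (disc (d c))) X (\<Phi> c)) \<and>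
     (\<forall>c\<in>C. inj_on (\<Phi> c) (open_disc (d c))) \<and>
     (\<forall>c\<in>C. \<forall>c'\<in>C. c \<noteq> c' \<longrightarrow> \<Phi> c ` open_disc (d c) \<inter> \<Phi> c' ` open_disc (d c') = {}) \<and>
     topspace X = (\<Union>c\<in>C. \<Phi> c ` open_disc (d c)) \<and>
     (\<forall>c\<in>C. \<Phi> c ` (disc (d c) - open_disc (d c))
              \<subseteq> (\<Union>c'\<in>{c'\<in>C. d c' < d c}. \<Phi> c' ` open_disc (d c')))"

text \<open>
  The cell \<open>None\<close> is the base 0-cell, and \<open>Some A\<close> is the cell of the critical face \<open>A\<close>.
  The base 0-cell belongs to the complex only because \<open>\<emptyset>\<close> is matched, so \<open>morse_complex\<close> is
  meant for trees in which \<open>\<emptyset>\<close> is not critical; the trees of the Comb Algorithm are of this kind.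
\<close>

fun cell_dim :: "'v set option \<Rightarrow> nat" where
  "cell_dim None = 0"
| "cell_dim (Some A) = card A - 1"

definition morse_complex :: "'v graph \<Rightarrow> 'v mtree \<Rightarrow> 'a topology \<Rightarrow> bool" where
  "morse_complex G T X \<longleftrightarrow>
     matching_tree G {} {} T \<and>
     (\<exists>\<Phi>. cell_structure X (insert None (Some ` critical_cells G {} {} T)) cell_dim \<Phi>) \<and>
     X homotopy_equivalent_space realization (Ind G)"


section \<open>The Comb Algorithm\<close>

text \<open>
  \<open>graft t u\<close> performs \<open>u\<close> below every final leaf of \<open>t\<close>. The leaves \<open>\<emptyset>\<close> produced by step (1)
  are not \<open>Final\<close>, so nothing is grafted below them.
\<close>

fun graft :: "'v mtree \<Rightarrow> 'v mtree \<Rightarrow> 'v mtree" where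
  "graft Final u = u"
| "graft (Free p) u = Free p"
| "graft (Forced p v t) u = Forced p v (graft t u)"
| "graft (Split v t t') u = Split v (graft t u) (graft t' u)"

text \<open>
  A path is given by the list of its vertices and is always consumed from the front. Consuming it
  from the other end gives the same number of critical cells in each dimension.
\<close>

fun path_tree :: "'v list \<Rightarrow> 'v mtree" where
  "path_tree [] = Final"
| "path_tree [p] = Free p"
| "path_tree [p, v] = Forced p v Final"
| "path_tree (p # v # w # ps) = Forced p v (path_tree ps)"

definition paths_tree :: "'v list list \<Rightarrow> 'v mtree" where
  "paths_tree pss = foldr (\<lambda>ps t. graft (path_tree ps) t) pss Final"

text \<open>
  All available graphs in the Comb Algorithm are copies of \<open>Y\<^sup>m\<^sub>l\<close>, \<open>Yhat m l\<close> and
  \<open>\<Delta>\<^sup>m\<^sub>l\<close> inside the original graph, obtained by taking a vertex \<open>c\<close> as the centre or as \<open>a\<close>,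
  \<open>PathV j (s + k)\<close> as \<open>(j,k)\<close>, \<open>Extra (s + k)\<close> as \<open>k\<close>, and \<open>EndB\<close> as \<open>b\<close>. The trees below take
  \<open>c\<close> and the shift \<open>s\<close> as arguments.
\<close>

definition tendril :: "nat \<Rightarrow> nat \<Rightarrow> nat \<Rightarrow> vertex list" where
  "tendril s l j = map (\<lambda>k. PathV j (s + k)) [1..<l + 1]"

definition Y_tree :: "nat \<Rightarrow> vertex \<Rightarrow> nat \<Rightarrow> nat \<Rightarrow> vertex mtree" where
  "Y_tree m c s l =
     (if l mod 3 = 0
      then graft (paths_tree (map (\<lambda>j. rev (tendril s l j)) [1..<m + 1])) (Free c)
      else Split c
             (paths_tree (map (\<lambda>j. tendril s l j) [1..<m + 1]))
             (paths_tree (map (\<lambda>j. tl (tendril s l j)) [1..<m + 1])))"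

definition Yhat_tree :: "nat \<Rightarrow> vertex \<Rightarrow> nat \<Rightarrow> nat \<Rightarrow> vertex mtree" where
  "Yhat_tree m c s l = Split EndB (Y_tree m c s l) (Y_tree m c s (l - 1))"

text \<open>
  \<open>comb_from m c s n k\<close> is the part of the Comb Algorithm for (the copy of) \<open>\<Delta>\<^sup>m\<^sub>n\<close> that starts at
  \<open>\<Sigma>(\<emptyset>, {1,\<dots>,k-1})\<close>. After \<open>k\<close> has been taken in, the available vertex \<open>k + 1\<close> plays the role
  of \<open>a\<close> in \<open>\<Delta>\<^sup>m\<close> with index \<open>n - (k + 1)\<close>. For \<open>n = 0\<close> this is the tree of
  \<open>\<Delta>\<^sup>m\<^sub>0\<close>, which is \<open>Yhat m 1\<close>.
\<close>

function comb_from :: "nat \<Rightarrow> vertex \<Rightarrow> nat \<Rightarrow> nat \<Rightarrow> nat \<Rightarrow> vertex mtree" where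
  "comb_from m c s n k =
     (if n < k then Yhat_tree m c s (n + 1)
      else Split (Extra (s + k))
             (comb_from m c s n (k + 1))
             (if k = 1 then Free c
              else if k = n then Free EndB
              else graft (Y_tree m c s (k - 1))
                     (comb_from m (Extra (s + k + 1)) (s + k + 1) (n - (k + 1)) 1)))"
  by pat_completeness auto
termination
  by (relation "measures [\<lambda>(m, c, s, n, k). n, \<lambda>(m, c, s, n, k). n + 1 - k]") auto

declare comb_from.simps [simp del]

definition comb_tree :: "nat \<Rightarrow> nat \<Rightarrow> vertex mtree" where
  "comb_tree m n = comb_from m EndA 0 n 1"

text \<open>
  The Comb Algorithm determines the cell complex \<open>X\<^sup>m\<^sub>n\<close> through its cells and its homotopy type,
  so \<open>X\<^sup>m\<^sub>n\<close> is rendered as a property of spaces: \<open>is_X m n X\<close> says that \<open>X\<close> is such a complex.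
\<close>

definition is_X :: "nat \<Rightarrow> nat \<Rightarrow> 'a topology \<Rightarrow> bool" where
  "is_X m n X \<longleftrightarrow>
     (if n = 0 then X homeomorphic_space nsphere 0
      else morse_complex (Delta m n) (comb_tree m n) X)"

end

theory Submission
  imports Defs "HOL-Library.Multiset"
begin

text \<open>
  The homology is read off from the cells alone. Put \<open>d = (2n + 2) div 3\<close>. For \<open>m \<ge> 4\<close> the Comb
  Algorithm produces one critical face with \<open>d + 1\<close> vertices if \<open>n mod 3 \<noteq> 2\<close> and none otherwise,
  and all remaining critical faces have at least \<open>d + 3\<close> vertices. Removing a top cell of dimension
  at least \<open>d + 2\<close> does not change reduced homology in degree \<open>d\<close>, so the complex may be
  replaced by its \<open>d\<close>-skeleton, which is a point with at most one \<open>d\<close>-cell attached.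
\<close>

section \<open>Critical cells of the Comb Algorithm\<close>

text \<open>The gap in dimension d + 1 is where \<open>m \<ge> 4\<close> enters. For n = 1 the leaf
  sizes are 2 and m while d = 1, so m = 3 would give a cell of dimension d + 1, and counting cells
  says nothing about its boundary. As n grows by 3, the leaves of the last branch grow by m, but d
  only by 2. Critical faces form a set, in which faces from different branches could coincide. Sizes
  are therefore computed as a multiset from the shape of the tree alone, and they are transferred to
  faces once the branches are known to be disjoint. On the topological side nothing is known about
  the attaching maps, so only facts valid for every attaching map are available. The one needed is
  the homology of a complex relative to the complement of an open top cell. Excision reduces it to
  an open disc relative to an outer shell, a pair that depends only on the dimension; its value is
  then read off from a hemisphere relative to its equator, which is a second instance of the same
  situation.\<close>

fun leaf_sizes :: "'v mtree \<Rightarrow> nat multiset" where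
  "leaf_sizes Final = {#0#}"
| "leaf_sizes (Free p) = {#}"
| "leaf_sizes (Forced p v t) = image_mset Suc (leaf_sizes t)"
| "leaf_sizes (Split v t u) = leaf_sizes t + image_mset Suc (leaf_sizes u)"

text \<open>The record admits arbitrary sets as edges. A loop {v} would put v into both
  \<open>A\<close> and \<open>B\<close> once it is taken in, and an empty edge would leave no
  independent set at all.\<close>

definition loop_free :: "'v graph \<Rightarrow> bool" where
  "loop_free G \<longleftrightarrow> (\<forall>e\<in>edges G. \<exists>u v. e = {u, v} \<and> u \<noteq> v)"

text \<open>Invariant of the nodes of a matching tree. As the neighbors of \<open>A\<close> are
  already in \<open>B\<close>, an available vertex has no neighbor in \<open>A\<close> and can be
  added without spoiling independence.\<close>

definition closed_node :: "'v graph \<Rightarrow> 'v set \<Rightarrow> 'v set \<Rightarrow> bool" where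
  "closed_node G A B \<longleftrightarrow> finite A \<and> A \<in> Ind G \<and> A \<inter> B = {} \<and> (\<forall>a\<in>A. nbrs G a \<subseteq> B)"

lemma closed_node_exclude:
  "closed_node G A B \<Longrightarrow> v \<notin> A \<Longrightarrow> closed_node G A (insert v B)"
  by (auto simp: closed_node_def)

lemma closed_node_include:
  assumes G: "loop_free G" and AB: "closed_node G A B" and v: "v \<in> verts G" "v \<notin> A \<union> B"
  shows "closed_node G (insert v A) (B \<union> nbrs G v)"
proof -
  have nv: "{a, v} \<notin> edges G" if "a \<in> A" for a
    using AB v that by (auto simp: closed_node_def nbrs_def)
  have "v \<notin> nbrs G v"
    using G by (fastforce simp: loop_free_def nbrs_def)
  moreover have "nbrs G v \<inter> A = {}"
    using nv by (auto simp: nbrs_def insert_commute)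
  moreover have "insert v A \<in> Ind G"
  proof -
    have "\<not> e \<subseteq> insert v A" if e: "e \<in> edges G" for e
    proof
      assume sub: "e \<subseteq> insert v A"
      obtain x y where xy: "e = {x, y}" "x \<noteq> y"
        using G e by (auto simp: loop_free_def)
      have "\<not> e \<subseteq> A"
        using AB e by (auto simp: closed_node_def Ind_def)
      then show False
        using sub xy nv[of x] nv[of y] e by (auto simp: insert_commute)
    qed
    then show ?thesis
      using AB v by (auto simp: closed_node_def Ind_def)
  qed
  ultimately show ?thesis
    using AB v by (auto simp: closed_node_def)
qed

text \<open>Separates the branches of a \<open>Split\<close>: the faces of one avoid
  \<open>v\<close>, those of the other contain it, so their union is disjoint and no size is
  lost.\<close>

lemma critical_cells_avoid:
  "matching_tree G A B T \<Longrightarrow> loop_free G \<Longrightarrow> closed_node G A B \<Longrightarrow> I \<in> critical_cells G A B T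
    \<Longrightarrow> A \<subseteq> I \<and> I \<inter> B = {}"
proof (induction T arbitrary: A B)
  case Final
  then show ?case by (auto simp: closed_node_def split: if_splits)
next
  case (Forced p v T)
  then have v: "v \<in> verts G" "v \<notin> A \<union> B"
    by (auto simp: nbrs_def)
  then show ?case
    using Forced.IH[of "insert v A" "B \<union> nbrs G v"] Forced.prems closed_node_include[OF _ _ v]
    by auto
next
  case (Split v T1 T2)
  then have v: "v \<in> verts G" "v \<notin> A \<union> B"
    by auto
  show ?case
  proof (cases "I \<in> critical_cells G A (insert v B) T1")
    case True
    then show ?thesis
      using Split.IH(1)[of A "insert v B"] Split.prems v closed_node_exclude[of G A B v] by auto
  next
    case False
    then show ?thesis
      using Split.IH(2)[of "insert v A" "B \<union> nbrs G v"] Split.prems closed_node_include[OF _ _ v]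
      by auto
  qed
qed auto

text \<open>Along a branch, every vertex taken in is new, and every final leaf is nonempty because the
  set taken in stays independent.\<close>

lemma card_critical_cells:
  "matching_tree G A B T \<Longrightarrow> loop_free G \<Longrightarrow> closed_node G A B \<Longrightarrow>
    finite (critical_cells G A B T) \<and>
    image_mset card (mset_set (critical_cells G A B T)) = {#card A + s. s \<in># leaf_sizes T#}"
proof (induction T arbitrary: A B)
  case Final
  then show ?case by (auto simp: closed_node_def Sigma_node_def)
next
  case (Free p)
  then show ?case by simp
next
  case (Forced p v T)
  then have v: "v \<in> verts G" "v \<notin> A \<union> B"
    by (auto simp: nbrs_def)
  with Forced closed_node_include[OF _ _ v] have
    "finite (critical_cells G (insert v A) (B \<union> nbrs G v) T) \<and>
    image_mset card (mset_set (critical_cells G (insert v A) (B \<union> nbrs G v) T))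
      = {#card (insert v A) + s. s \<in># leaf_sizes T#}"
    by auto
  moreover have "card (insert v A) = Suc (card A)"
    using v Forced.prems by (simp add: closed_node_def)
  ultimately show ?case
    by (simp add: multiset.map_comp comp_def)
next
  case (Split v T U)
  then have v: "v \<in> verts G" "v \<notin> A \<union> B" and
    m: "matching_tree G A (insert v B) T" "matching_tree G (insert v A) (B \<union> nbrs G v) U"
    by auto
  have cl: "closed_node G A (insert v B)" "closed_node G (insert v A) (B \<union> nbrs G v)"
    using closed_node_include[OF _ _ v] closed_node_exclude[of G A B v] v Split.prems by auto
  have c: "card (insert v A) = Suc (card A)"
    using v Split.prems by (simp add: closed_node_def)
  let ?T = "critical_cells G A (insert v B) T"
  let ?U = "critical_cells G (insert v A) (B \<union> nbrs G v) U"
  have disj: "?T \<inter> ?U = {}"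
    using critical_cells_avoid[OF m(1) _ cl(1)] critical_cells_avoid[OF m(2) _ cl(2)] Split.prems
    by blast
  have "finite ?T \<and> image_mset card (mset_set ?T) = {#card A + s. s \<in># leaf_sizes T#}"
    using Split.IH(1)[OF m(1) _ cl(1)] Split.prems by blast
  moreover have "finite ?U \<and> image_mset card (mset_set ?U)
      = {#card (insert v A) + s. s \<in># leaf_sizes U#}"
    using Split.IH(2)[OF m(2) _ cl(2)] Split.prems by blast
  ultimately show ?case
    using disj c by (simp add: mset_set_Union multiset.map_comp comp_def)
qed

section \<open>Leaf sizes of grafted trees, paths, extended stars and their two-ended
  versions\<close>

lemma plus_0: "(+) (0::nat) = id"
  by auto

text \<open>Grafting repeats \<open>u\<close> below each final leaf, but every tree that the Comb
  Algorithm grafts onto has at most one, so these two cases suffice.\<close>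

lemma leaf_sizes_graft:
  "leaf_sizes t = {#s#} \<Longrightarrow> leaf_sizes (graft t u) = {#s + r. r \<in># leaf_sizes u#}"
  "leaf_sizes t = {#} \<Longrightarrow> leaf_sizes (graft t u) = {#}"
proof (induction t arbitrary: s)
  case Final
  { case 1
    then show ?case using plus_0 by simp }
  { case 2
    then show ?case by simp }
next
  case (Forced p v t)
  { case 1
    then obtain r where "s = Suc r" "leaf_sizes t = {#r#}"
      by (auto dest: msed_map_invR)
    then show ?case
      using Forced.IH(1)[of r] by (simp add: multiset.map_comp comp_def) }
  { case 2
    then show ?case using Forced.IH(2) by simp }
next
  case (Split v t t')
  { case 1
    then consider "leaf_sizes t = {#s#}" "leaf_sizes t' = {#}"
      | r where "s = Suc r" "leaf_sizes t = {#}" "leaf_sizes t' = {#r#}"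
      by (auto simp: union_is_single dest: msed_map_invR)
    then show ?case
      using Split.IH by cases (simp_all add: multiset.map_comp comp_def) }
  { case 2
    then show ?case using Split.IH by simp }
qed auto

text \<open>A forced step takes in one vertex and uses up three. One vertex left over is free and
  destroys the leaf; two left over cost one more vertex.\<close>

lemma leaf_sizes_path_tree:
  "leaf_sizes (path_tree ps) =
    (if length ps mod 3 = 1 then {#} else {#(length ps + 1) div 3#})"
proof (induction ps rule: path_tree.induct)
  case (4 p v w ps)
  have "length (p # v # w # ps) mod 3 = length ps mod 3"
    "(length (p # v # w # ps) + 1) div 3 = Suc ((length ps + 1) div 3)"
    by auto
  with 4 show ?case by (simp del: length_Cons)
qed auto

lemma leaf_sizes_paths_tree:
  assumes "\<And>ps. ps \<in> set pss \<Longrightarrow> length ps = l"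
  shows "leaf_sizes (paths_tree pss) =
    (if pss \<noteq> [] \<and> l mod 3 = 1 then {#} else {#length pss * ((l + 1) div 3)#})"
  using assms
proof (induction pss)
  case Nil
  then show ?case by (simp add: paths_tree_def)
next
  case (Cons ps pss)
  then have "leaf_sizes (path_tree ps) = (if l mod 3 = 1 then {#} else {#(l + 1) div 3#})"
    by (simp add: leaf_sizes_path_tree)
  moreover have "paths_tree (ps # pss) = graft (path_tree ps) (paths_tree pss)"
    by (simp add: paths_tree_def)
  ultimately show ?case
    using Cons by (auto simp: leaf_sizes_graft)
qed

lemma three_cases: "k < 3 \<Longrightarrow> k = 0 \<or> k = 1 \<or> k = (2::nat)"
  by auto

lemma div_mod_3:
  "Suc (3 * k) div 3 = k" "Suc (Suc (3 * k)) div 3 = k"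
  "Suc (3 * k) mod 3 = Suc 0" "Suc (Suc (3 * k)) mod 3 = 2"
  by presburger+

lemma length_tendril [simp]: "length (tendril s l j) = l"
  by (simp add: tendril_def)

text \<open>At most one branch survives. If 3 divides \<open>l\<close>, the center becomes free.
  Otherwise leaving the center out gives paths with \<open>l\<close> vertices and taking it in gives
  paths with \<open>l - 1\<close>; whichever length is 1 modulo 3 ends in free vertices.\<close>

lemma leaf_sizes_Y_tree:
  assumes "m \<ge> 1"
  shows "leaf_sizes (Y_tree m c s l) =
    (if l mod 3 = 0 then {#} else if l mod 3 = 1 then {#m * (l div 3) + 1#}
     else {#m * (l div 3 + 1)#})"
proof -
  have ne: "map f [1..<m + 1] \<noteq> []" for f :: "nat \<Rightarrow> vertex list"
    using assms by simp
  have "l = 3 * (l div 3) + l mod 3" by simp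
  then consider "l mod 3 = 0" | k where "l = 3 * k + 1" | k where "l = 3 * k + 2"
    by (metis add_0 three_cases mod_less_divisor zero_less_numeral One_nat_def numeral_2_eq_2)
  then show ?thesis
  proof cases
    case 1
    have "leaf_sizes (paths_tree (map (\<lambda>j. rev (tendril s l j)) [1..<m + 1]))
      = {#m * ((l + 1) div 3)#}"
      using 1 by (subst leaf_sizes_paths_tree[where l = l]) auto
    then show ?thesis
      using 1 by (simp add: Y_tree_def leaf_sizes_graft)
  next
    case 2
    have "leaf_sizes (paths_tree (map (tendril s l) [1..<m + 1])) = {#}"
      using 2 ne by (subst leaf_sizes_paths_tree[where l = l]) auto
    moreover have "leaf_sizes (paths_tree (map (\<lambda>j. tl (tendril s l j)) [1..<m + 1]))
      = {#m * (l div 3)#}"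
      using 2 ne by (subst leaf_sizes_paths_tree[where l = "l - 1"]) auto
    ultimately show ?thesis
      using 2 by (simp add: Y_tree_def)
  next
    case 3
    have "leaf_sizes (paths_tree (map (tendril s l) [1..<m + 1])) = {#m * (l div 3 + 1)#}"
      using 3 ne by (subst leaf_sizes_paths_tree[where l = l]) (auto simp: div_mod_3)
    moreover have "leaf_sizes (paths_tree (map (\<lambda>j. tl (tendril s l j)) [1..<m + 1])) = {#}"
      using 3 ne by (subst leaf_sizes_paths_tree[where l = "l - 1"]) (auto simp: div_mod_3)
    ultimately show ?thesis
      using 3 by (simp add: Y_tree_def div_mod_3)
  qed
qed

text \<open>Here \<open>n\<close> is the index of the \<Delta> graph whose last comb node has
  \<open>Yhat m (n + 1)\<close> available. Omitting \<open>EndB\<close> leaves an extended star with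
  tendrils of length \<open>n + 1\<close>, taking it in one of length \<open>n\<close>; both survive
  only for \<open>n\<close> congruent to 1.\<close>

lemma leaf_sizes_Yhat_tree:
  assumes "m \<ge> 1"
  shows "leaf_sizes (Yhat_tree m c s (n + 1)) =
    (if n mod 3 = 0 then {#m * (n div 3) + 1#}
     else if n mod 3 = 1 then {#m * (n div 3 + 1), m * (n div 3) + 2#}
     else {#m * (n div 3 + 1) + 1#})"
proof -
  have "n = 3 * (n div 3) + n mod 3" by simp
  then consider k where "n = 3 * k" | k where "n = 3 * k + 1" | k where "n = 3 * k + 2"
    by (metis add_0_right three_cases mod_less_divisor zero_less_numeral)
  then show ?thesis
    by cases (simp_all add: Yhat_tree_def leaf_sizes_Y_tree[OF assms] div_mod_3)
qed

text \<open>Writing n = 3k + r, the sizes grow at least like 4k and the bound like 2k. For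
  \<open>m = 4\<close> equality occurs at \<open>n\<close> = 2, 3 and 4; for \<open>n\<close> = 0
  and 1 this tree contains the small leaf itself.\<close>

lemma large_leaf_sizes_Yhat_tree:
  assumes "m \<ge> 4" "n \<ge> 2" "x \<in># leaf_sizes (Yhat_tree m c s (n + 1))"
  shows "x \<ge> (2 * n + 2) div 3 + 3"
proof -
  obtain k r where n: "n = 3 * k + r" "r < 3"
    using that[of "n div 3" "n mod 3"] by simp
  \<comment> \<open>With the product \<open>m * k\<close> named \<open>q\<close>, all remaining
    estimates are linear.\<close>
  obtain q where q: "m * k = q" "m * (k + 1) = q + m" "q \<ge> 4 * k"
    using assms(1) by simp
  consider "r = 0" | "r = 1" | "r = 2"
    using n by linarith
  then show ?thesis
  proof cases
    case 1
    then have "n div 3 = k" "n mod 3 = 0" using n by simp_all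
    then have "x = q + 1"
      using assms leaf_sizes_Yhat_tree[of m c s n] q(1,2) by simp
    moreover have "(2 * n + 2) div 3 = 2 * k"
      using n 1 by simp
    moreover have "k \<ge> 1"
      using assms(2) n 1 by simp
    ultimately show ?thesis
      using assms(1) q(3) by linarith
  next
    case 2
    then have "n div 3 = k" "n mod 3 = 1" using n by simp_all
    then have "x = q + m \<or> x = q + 2"
      using assms leaf_sizes_Yhat_tree[of m c s n] q(1,2) by auto
    moreover have "(2 * n + 2) div 3 = 2 * k + 1"
      using n 2 by simp
    moreover have "k \<ge> 1"
      using assms(2) n 2 by simp
    ultimately show ?thesis
      using assms(1) q(3) by linarith
  next
    case 3
    then have "n div 3 = k" "n mod 3 = 2" using n by (simp_all add: div_mod_3)
    then have "x = q + m + 1"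
      using assms leaf_sizes_Yhat_tree[of m c s n] q(1,2) by simp
    moreover have "(2 * n + 2) div 3 = 2 * k + 2"
      using n 3 by simp
    ultimately show ?thesis
      using assms(1) q(3) by linarith
  qed
qed

text \<open>
  For \<open>n \<ge> 3\<close> the leaves with at most \<open>d\<^sub>n + 2\<close> vertices come only from the branch that takes
  in \<open>Extra (s + 2)\<close>, whose available graph contains a copy of \<open>Y\<^sup>m\<^sub>1\<close> (one leaf, of size 1) and a
  copy of \<open>\<Delta>\<^sup>m\<close> with index \<open>n - 3\<close>.
\<close>

definition comb_leaves :: "nat \<Rightarrow> nat multiset \<Rightarrow> bool" where
  "comb_leaves n M \<longleftrightarrow> (\<exists>N. (\<forall>x\<in>#N. x \<ge> (2 * n + 2) div 3 + 3) \<and>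
     M = (if n mod 3 = 2 then {#} else {#(2 * n + 2) div 3 + 1#}) + N)"

lemma comb_leaves_lower_bound:
  assumes "comb_leaves n M" "x \<in># M"
  shows "x \<ge> (2 * n + 2) div 3 + 1"
proof -
  obtain d where d: "d = (2 * n + 2) div 3" by simp
  show ?thesis
    using assms unfolding comb_leaves_def d[symmetric] by (fastforce split: if_splits)
qed

lemma leaf_sizes_comb_from:
  assumes "k \<le> n"
  shows "leaf_sizes (comb_from m c s n k) = leaf_sizes (comb_from m c s n (k + 1)) +
    {#Suc r. r \<in># if k = 1 \<or> k = n then {#} else
       leaf_sizes (graft (Y_tree m c s (k - 1))
         (comb_from m (Extra (s + k + 1)) (s + k + 1) (n - (k + 1)) 1))#}"
  using assms by (subst comb_from.simps) auto

text \<open>If \<open>k - 1 = 3 * j + r\<close> and a = n - (k + 1), then n = a + 3j + r + 2; the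
  two lines are the cases r = 1 and r = 2.\<close>

lemma index_shift:
  "(2 * (a + 3 * j + 3) + 2) div 3 = (2 * a + 2) div 3 + 2 * j + (2::nat)"
  "(2 * (a + 3 * j + 4) + 2) div 3 \<le> (2 * a + 2) div 3 + 2 * j + (3::nat)"
  by simp_all

text \<open>Descending through the comb, each branch adds the vertex \<open>k\<close>, the leaf of
  the extended star and a leaf of the smaller \<Delta> graph. With e the bound for the latter, these
  sum to at least e + 4j + 3 for r = 1 and e + 4j + 6 for r = 2, against required values of at most
  e + 2j + 5 and e + 2j + 6. Only r = 1, j = 0, that is \<open>k = 2\<close>, would fall
  short.\<close>

lemma large_leaf_sizes_comb_from:
  assumes m: "m \<ge> 4" and n: "n \<ge> 2" and k: "k \<ge> 3"
    and IH: "\<And>n' c s. n' < n \<Longrightarrow> comb_leaves n' (leaf_sizes (comb_from m c s n' 1))"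
    and x: "x \<in># leaf_sizes (comb_from m c s n k)"
  shows "x \<ge> (2 * n + 2) div 3 + 3"
  using k x
proof (induction "n + 1 - k" arbitrary: k x)
  case 0
  then show ?case
    using large_leaf_sizes_Yhat_tree[OF m n, of x c s]
    by (subst (asm) comb_from.simps) auto
next
  case (Suc i)
  then have "\<not> n < k" by simp
  let ?t = "graft (Y_tree m c s (k - 1))
    (comb_from m (Extra (s + k + 1)) (s + k + 1) (n - (k + 1)) 1)"
  consider "x \<in># leaf_sizes (comb_from m c s n (k + 1))"
    | y where "x = Suc y" "k < n" "y \<in># leaf_sizes ?t"
    using Suc.prems \<open>\<not> n < k\<close> leaf_sizes_comb_from[of k n m c s]
    by (auto split: if_splits)
  then show ?case
  proof cases
    case 1
    moreover have "i = n + 1 - (k + 1)" using Suc.hyps(2) by simp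
    ultimately show ?thesis using Suc.hyps(1)[of "k + 1" x] Suc.prems by simp
  next
    case 2
    note kn = \<open>k < n\<close> and y = 2(3)
    let ?n = "n - (k + 1)"
    let ?F = "leaf_sizes (comb_from m (Extra (s + k + 1)) (s + k + 1) ?n 1)"
    obtain e where e: "e = (2 * ?n + 2) div 3" by simp
    have F: "z \<ge> e + 1" if "z \<in># ?F" for z
      using comb_leaves_lower_bound[OF IH that] kn e by simp
    obtain j r where jr: "k - 1 = 3 * j + r" "r < 3"
      using that[of "(k - 1) div 3" "(k - 1) mod 3"] by simp
    obtain q where q: "m * j = q" "m * (j + 1) = q + m" "q \<ge> 4 * j"
      using m by simp
    have Y: "leaf_sizes (Y_tree m c s (k - 1)) =
      (if r = 0 then {#} else if r = 1 then {#q + 1#} else {#q + m#})"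
      using leaf_sizes_Y_tree[of m c s "k - 1"] m jr q(1,2) by auto
    consider "r = 0" | "r = 1" | "r = 2"
      using jr by linarith
    then show ?thesis
    proof cases
      case 1
      then show ?thesis using y Y by (simp add: leaf_sizes_graft(2))
    next
      case r: 2
      then obtain z where "z \<in># ?F" "y = q + 1 + z"
        using y Y leaf_sizes_graft(1)[of "Y_tree m c s (k - 1)" "q + 1"] by auto
      moreover have "n = ?n + 3 * j + 3" using r jr kn by simp
      then have "(2 * n + 2) div 3 = e + 2 * j + 2"
        using index_shift(1)[of ?n j] e by metis
      \<comment> \<open>The hypothesis \<open>k \<ge> 3\<close> rules out the exceptional branch
        \<open>k = 2\<close>.\<close>
      moreover have "j \<ge> 1" using r jr Suc.prems by simp
      ultimately show ?thesis
        using F[of z] q(3) \<open>x = Suc y\<close> by simp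
    next
      case r: 3
      then obtain z where "z \<in># ?F" "y = q + m + z"
        using y Y leaf_sizes_graft(1)[of "Y_tree m c s (k - 1)" "q + m"] by auto
      moreover have "n = ?n + 3 * j + 4" using r jr kn by simp
      then have "(2 * n + 2) div 3 \<le> e + 2 * j + 3"
        using index_shift(2)[of ?n j] e by metis
      ultimately show ?thesis
        using F[of z] q(3) m \<open>x = Suc y\<close> by simp
    qed
  qed
qed

text \<open>For \<open>n \<le> 2\<close> every comb branch ends in a free vertex, so only the final
  two-ended star counts. For \<open>n \<ge> 3\<close> the branch of the second extra vertex adds two
  vertices, this vertex and the center of the star, exactly the growth of the bound from
  \<open>n - 3\<close> to \<open>n\<close>; the residue of \<open>n\<close> modulo 3 is preserved as
  well.\<close>

lemma comb_leaves_comb_from: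
  assumes m: "m \<ge> 4"
  shows "comb_leaves n (leaf_sizes (comb_from m c s n 1))"
proof (induction n arbitrary: c s rule: less_induct)
  case (less n)
  consider "n = 0" | "n = 1" | "n = 2" | "n \<ge> 3" by linarith
  then show ?case
  proof cases
    case 1
    then have "leaf_sizes (comb_from m c s n 1) = {#1#}"
      using leaf_sizes_Yhat_tree[of m c s 0] m by (subst comb_from.simps) simp
    then show ?thesis using 1 by (simp add: comb_leaves_def)
  next
    case 2
    then have "leaf_sizes (comb_from m c s n 1) = leaf_sizes (Yhat_tree m c s (1 + 1))"
      using leaf_sizes_comb_from[of 1 n m c s] comb_from.simps[of m c s 1 2] by (simp add: numeral_2_eq_2)
    also have "\<dots> = {#2#} + {#m#}"
      using m by (subst leaf_sizes_Yhat_tree) auto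
    \<comment> \<open>Here d = 1, so the second leaf is large enough precisely when \<open>m\<close>
      is at least d + 3 = 4.\<close>
    finally show ?thesis using 2 m unfolding comb_leaves_def
      by (intro exI[of _ "{#m#}"]) simp
  next
    case 3
    then have "leaf_sizes (comb_from m c s n 1) = leaf_sizes (Yhat_tree m c s (2 + 1))"
      using leaf_sizes_comb_from[of 1 n m c s] leaf_sizes_comb_from[of 2 n m c s]
        comb_from.simps[of m c s 2 3] by (simp add: numeral_2_eq_2 numeral_3_eq_3)
    also have "\<dots> = {#m + 1#}"
      using m by (subst leaf_sizes_Yhat_tree) auto
    finally show ?thesis using 3 m unfolding comb_leaves_def
      by (intro exI[of _ "{#m + 1#}"]) simp
  next
    case 4
    let ?F = "leaf_sizes (comb_from m (Extra (s + 3)) (s + 3) (n - 3) 1)"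
    have Y1: "leaf_sizes (Y_tree m c s 1) = {#1#}"
      using leaf_sizes_Y_tree[of m c s 1] m by simp
    have "leaf_sizes (comb_from m c s n 1) = leaf_sizes (comb_from m c s n 2)"
      using 4 leaf_sizes_comb_from[of 1 n m c s] by (simp add: numeral_2_eq_2)
    also have "\<dots> = leaf_sizes (comb_from m c s n 3) +
        {#Suc r. r \<in># leaf_sizes (graft (Y_tree m c s 1)
           (comb_from m (Extra (s + 3)) (s + 3) (n - 3) 1))#}"
      using 4 leaf_sizes_comb_from[of 2 n m c s] by (simp add: numeral_3_eq_3)
    also have "\<dots> = leaf_sizes (comb_from m c s n 3) + {#2 + r. r \<in># ?F#}"
      unfolding leaf_sizes_graft(1)[OF Y1] by (simp add: multiset.map_comp comp_def)
    finally have eq: "leaf_sizes (comb_from m c s n 1)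
      = leaf_sizes (comb_from m c s n 3) + {#2 + r. r \<in># ?F#}" .
    have "comb_leaves (n - 3) ?F"
      by (rule less) (use 4 in simp)
    then obtain N where N: "\<forall>x\<in>#N. x \<ge> (2 * (n - 3) + 2) div 3 + 3"
      "?F = (if (n - 3) mod 3 = 2 then {#} else {#(2 * (n - 3) + 2) div 3 + 1#}) + N"
      unfolding comb_leaves_def by blast
    obtain i where i: "n = i + 3"
      using 4 by (metis add.commute le_Suc_ex)
    have d: "(2 * n + 2) div 3 = (2 * i + 2) div 3 + 2"
      using i by simp
    have L: "x \<ge> (2 * n + 2) div 3 + 3" if "x \<in># leaf_sizes (comb_from m c s n 3)" for x
      by (rule large_leaf_sizes_comb_from[OF m _ _ less that]) (use 4 in auto)
    let ?N = "leaf_sizes (comb_from m c s n 3) + {#2 + r. r \<in># N#}"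
    have "x \<ge> (2 * n + 2) div 3 + 3" if x: "x \<in># ?N" for x
    proof (cases "x \<in># leaf_sizes (comb_from m c s n 3)")
      case False
      with x obtain r where r: "r \<in># N" "x = 2 + r" by auto
      with N(1) have "(2 * i + 2) div 3 + 3 \<le> r"
        by (simp only: i add_diff_cancel_right')
      with r d show ?thesis by simp
    qed (rule L)
    moreover have "leaf_sizes (comb_from m c s n 1)
      = (if n mod 3 = 2 then {#} else {#(2 * n + 2) div 3 + 1#}) + ?N"
    proof -
      have "n mod 3 = i mod 3" "n - 3 = i" using i by simp_all
      then show ?thesis
        unfolding eq N(2) d by (simp add: union_ac del: add_2_eq_Suc)
    qed
    ultimately show ?thesis
      unfolding comb_leaves_def by blast
  qed
qed

section \<open>From leaf sizes back to critical faces\<close>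

lemma loop_free_Delta: "loop_free (Delta m n)"
proof -
  have "\<exists>u v. e = {u, v} \<and> u \<noteq> v" if e: "e \<in> edges (Delta m n)" for e
  proof -
    consider j k where "e = {EndA, PathV j k}" | j k where "e = {PathV j k, PathV j (k + 1)}"
      | j k where "e = {PathV j k, EndB}" | i j k where "e = {Extra i, PathV j k}"
      using e unfolding Delta_def Yhat_def graph.simps Un_iff mem_Collect_eq by blast
    then show ?thesis
      by cases (metis vertex.distinct vertex.inject(1) n_not_Suc_n Suc_eq_plus1)+
  qed
  then show ?thesis by (simp add: loop_free_def)
qed

lemma critical_cells_comb_tree:
  assumes m: "m \<ge> 4" and T: "matching_tree (Delta m n) {} {} (comb_tree m n)"
  defines "C \<equiv> critical_cells (Delta m n) {} {} (comb_tree m n)"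
    and "d \<equiv> (2 * n + 2) div 3"
  obtains "n mod 3 = 2" "\<And>A. A \<in> C \<Longrightarrow> card A \<ge> d + 3"
  | A where "n mod 3 \<noteq> 2" "A \<in> C" "card A = d + 1"
      "\<And>B. B \<in> C \<Longrightarrow> B \<noteq> A \<Longrightarrow> card B \<ge> d + 3"
proof -
  have "closed_node (Delta m n) {} {}"
    using loop_free_Delta[of m n] unfolding closed_node_def Ind_def loop_free_def by blast
  from card_critical_cells[OF T loop_free_Delta this]
  have fin: "finite C" and eq: "image_mset card (mset_set C) = leaf_sizes (comb_tree m n)"
    by (auto simp: C_def plus_0)
  from comb_leaves_comb_from[OF m, of n EndA 0]
  obtain N where N: "\<forall>x\<in>#N. x \<ge> d + 3"
    "image_mset card (mset_set C) = (if n mod 3 = 2 then {#} else {#d + 1#}) + N"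
    unfolding comb_leaves_def eq d_def comb_tree_def by blast
  show thesis
  proof (cases "n mod 3 = 2")
    case True
    have "card A \<ge> d + 3" if "A \<in> C" for A
    proof -
      have "card A \<in># image_mset card (mset_set C)"
        using that fin by simp
      then show ?thesis using N True by simp
    qed
    with True show thesis using that by blast
  next
    case False
    then have "image_mset card (mset_set C) = add_mset (d + 1) N"
      using N by simp
    \<comment> \<open>Pulling one element of the image multiset back to a face keeps the
      multiplicities: \<open>M\<close> holds exactly the other faces, and their sizes form
      \<open>N\<close>.\<close>
    then obtain A M where A: "mset_set C = add_mset A M" "card A = d + 1" "image_mset card M = N"
      using msed_map_invR[of card "mset_set C" "d + 1" N] by blast
    have "A \<in> C"
      using A(1) fin elem_mset_set[of C A] by simp
    then have M: "M = mset_set (C - {A})"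
      using A(1) fin by (simp add: mset_set.remove)
    have "card B \<ge> d + 3" if "B \<in> C" "B \<noteq> A" for B
    proof -
      have "card B \<in># image_mset card M"
        using that fin M by simp
      then show ?thesis using N(1) A(3) by simp
    qed
    with False \<open>A \<in> C\<close> A(2) show thesis using that by blast
  qed
qed


section \<open>Discs\<close>

definition disc_norm :: "nat \<Rightarrow> (nat \<Rightarrow> real) \<Rightarrow> real" where
  "disc_norm k x = sqrt (\<Sum>i<k. (x i)\<^sup>2)"

lemma disc_eq: "disc k = {x. (\<forall>i\<ge>k. x i = 0) \<and> disc_norm k x \<le> 1}"
  by (auto simp: disc_def disc_norm_def)

lemma open_disc_eq: "open_disc k = {x. (\<forall>i\<ge>k. x i = 0) \<and> disc_norm k x < 1}"
  by (auto simp: open_disc_def disc_norm_def)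

lemma disc_norm_nonneg: "0 \<le> disc_norm k x"
  by (simp add: disc_norm_def sum_nonneg)

lemma continuous_on_disc_norm: "continuous_on S (disc_norm k)"
  unfolding disc_norm_def
  by (intro continuous_intros continuous_on_subset[OF continuous_on_product_coordinates]) auto

lemma disc_norm_scale: "disc_norm k (\<lambda>i. c * x i) = \<bar>c\<bar> * disc_norm k x"
  by (simp add: disc_norm_def power_mult_distrib real_sqrt_mult flip: sum_distrib_left)

lemma open_disc_subset: "open_disc k \<subseteq> disc k"
  by (auto simp: disc_eq open_disc_eq)

text \<open>Passes to the topology of the function type, where continuity can be checked with
  \<open>continuous_on\<close>.\<close>

lemma subtopology_Euclidean_disc:
  "S \<subseteq> disc k \<Longrightarrow> subtopology (Euclidean_space k) S = top_of_set S"
  unfolding Euclidean_space_def euclidean_product_topology subtopology_subtopology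
  by (rule arg_cong[where f = top_of_set]) (auto simp: disc_def)

lemma closed_disc: "closed (disc k)"
proof -
  have "disc k = (\<Inter>i\<in>{k..}. {x. x i = 0}) \<inter> {x. disc_norm k x \<le> 1}"
    by (auto simp: disc_eq)
  moreover have "closed {x. disc_norm k x \<le> 1}"
    by (intro closed_Collect_le continuous_on_disc_norm continuous_intros)
  moreover have "closed {x::nat \<Rightarrow> real. x i = 0}" for i
    by (intro closed_Collect_eq continuous_on_product_coordinates continuous_intros)
  ultimately show ?thesis by (auto intro!: closed_Int closed_INT)
qed

lemma compact_disc: "compact (disc k)"
proof -
  have "compactin (powertop_real UNIV) (\<Pi>\<^sub>E i\<in>UNIV. {-1..1::real})"
    by (simp add: compactin_PiE)
  then have "compact (\<Pi>\<^sub>E i\<in>UNIV. {-1..1::real})"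
    by (simp add: euclidean_product_topology)
  moreover have "disc k \<subseteq> (\<Pi>\<^sub>E i\<in>UNIV. {-1..1::real})"
  proof
    fix x assume x: "x \<in> disc k"
    have "\<bar>x i\<bar> \<le> 1" for i
    proof (cases "i < k")
      case True
      then have "(x i)\<^sup>2 \<le> (\<Sum>i<k. (x i)\<^sup>2)"
        by (intro member_le_sum) auto
      also have "\<dots> \<le> 1" using x by (simp add: disc_def)
      finally show ?thesis by (simp add: abs_square_le_1)
    qed (use x in \<open>auto simp: disc_def\<close>)
    then show "x \<in> (\<Pi>\<^sub>E i\<in>UNIV. {-1..1::real})"
      by (auto simp: abs_le_iff PiE_def minus_le_iff)
  qed
  ultimately show ?thesis
    using compact_Int_closed[OF _ closed_disc] by (metis inf.absorb2)
qed

text \<open>At time 1 the whole shell \<open>1/2 \<le> |x| \<le> 1\<close> has been pushed onto the boundary sphere.\<close>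

definition push :: "nat \<Rightarrow> real \<Rightarrow> (nat \<Rightarrow> real) \<Rightarrow> nat \<Rightarrow> real" where
  "push k t x = (\<lambda>i. inverse (max (inverse (1 + t)) (disc_norm k x)) * x i)"

lemma disc_norm_push:
  assumes "0 \<le> t"
  shows "disc_norm k (push k t x) = disc_norm k x / max (inverse (1 + t)) (disc_norm k x)"
proof -
  have "0 < max (inverse (1 + t)) (disc_norm k x)"
    using assms by (simp add: less_max_iff_disj)
  then show ?thesis
    unfolding push_def disc_norm_scale by (simp add: divide_inverse mult.commute)
qed

lemma push_in_disc:
  assumes "0 \<le> t" "x \<in> disc k" shows "push k t x \<in> disc k"
proof -
  have "push k t x i = 0" if "i \<ge> k" for i
    using that assms by (simp add: push_def disc_eq)
  moreover have "disc_norm k (push k t x) \<le> 1"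
    using assms disc_norm_nonneg[of k x]
    by (auto simp: disc_eq disc_norm_push divide_le_eq less_max_iff_disj)
  ultimately show ?thesis by (simp add: disc_eq)
qed

lemma disc_norm_push_ge:
  assumes "0 \<le> t" "x \<in> disc k" shows "disc_norm k x \<le> disc_norm k (push k t x)"
proof -
  have "0 < max (inverse (1 + t)) (disc_norm k x)" "max (inverse (1 + t)) (disc_norm k x) \<le> 1"
    using assms by (auto simp: disc_eq less_max_iff_disj inverse_le_1_iff)
  then show ?thesis
    using disc_norm_nonneg[of k x] assms(1)
    by (simp add: disc_norm_push pos_le_divide_eq mult_left_le)
qed

lemma push_0: "x \<in> disc k \<Longrightarrow> push k 0 x = x"
  by (auto simp: push_def disc_eq max_def)

text \<open>This is what lets the push descend along a characteristic map, which may identify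
  boundary points.\<close>

lemma push_boundary: "0 \<le> t \<Longrightarrow> x \<in> disc k - open_disc k \<Longrightarrow> push k t x = x"
  by (auto simp: push_def disc_eq open_disc_eq max_def inverse_le_1_iff)

lemma push_1:
  "x \<in> disc k \<Longrightarrow> disc_norm k x > 1/2 \<Longrightarrow> push k 1 x \<in> disc k - open_disc k"
  using push_in_disc[of 1 x k] by (auto simp: open_disc_eq disc_norm_push max_def)

text \<open>For times in [0,1] the maximum that is inverted stays at least 1/2, so the origin causes
  no trouble.\<close>

lemma continuous_on_push:
  "continuous_on ({0..1} \<times> disc k) (\<lambda>(t, x). push k t x)"
proof -
  have "continuous_on ({0..1} \<times> disc k) (\<lambda>z. push k (fst z) (snd z) i)" for i
    unfolding push_def
    by (intro continuous_intros continuous_on_compose2[OF continuous_on_disc_norm[of UNIV]]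
        continuous_on_compose2[OF continuous_on_product_coordinates[of i]])
       (auto simp: max_def)
  then show ?thesis
    by (simp add: case_prod_unfold continuous_on_coordinatewise_then_product)
qed

section \<open>Attaching a cell\<close>

text \<open>Attaching a cell, stated intrinsically: the disc is compact and \<open>X\<close> is
  Hausdorff, so \<open>\<Phi>\<close> is a closed map and \<open>X\<close> has the topology of the
  adjunction space without this being assumed. Top cells of a complex and hemispheres both fit this
  form.\<close>

locale attached_cell =
  fixes X :: "'a topology" and Y :: "'a set" and k :: nat and \<Phi> :: "(nat \<Rightarrow> real) \<Rightarrow> 'a"
  assumes Hausdorff: "Hausdorff_space X"
    and closedin_Y: "closedin X Y"
    and continuous: "continuous_map (top_of_set (disc k)) X \<Phi>"
    and inj: "inj_on \<Phi> (open_disc k)"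
    and cell: "\<Phi> ` open_disc k = topspace X - Y"
    and boundary: "\<Phi> ` (disc k - open_disc k) \<subseteq> Y"
begin

lemma disc_cases:
  assumes "x \<in> disc k"
  obtains "x \<in> open_disc k" "\<Phi> x \<notin> Y" "\<Phi> x \<in> topspace X"
    | "x \<in> disc k - open_disc k" "\<Phi> x \<in> Y" "\<Phi> x \<in> topspace X"
  using assms cell boundary closedin_subset[OF closedin_Y] by blast

lemma topspace_eq: "topspace X = Y \<union> \<Phi> ` disc k"
  using cell boundary closedin_subset[OF closedin_Y] open_disc_subset by blast

lemma compact_space_disc: "compact_space (top_of_set (disc k))"
  using compact_disc by (simp add: compact_space_subtopology)

lemma closed_map: "closed_map (top_of_set (disc k)) X \<Phi>"
  using continuous compact_space_disc Hausdorff by (rule continuous_imp_closed_map)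

text \<open>By the boundary condition the open disc is the full preimage of the complement of
  \<open>Y\<close>, and a closed map stays closed when restricted to a full preimage.\<close>

lemma homeomorphic_map_cell:
  "homeomorphic_map (top_of_set (open_disc k)) (subtopology X (topspace X - Y)) \<Phi>"
proof -
  have eq: "{x \<in> topspace (top_of_set (disc k)). \<Phi> x \<in> topspace X - Y} = open_disc k"
    by (auto elim: disc_cases dest: subsetD[OF open_disc_subset])
  have "subtopology (top_of_set (disc k)) (open_disc k) = top_of_set (open_disc k)"
    using open_disc_subset by (simp add: subtopology_subtopology Int_absorb1)
  then have "closed_map (top_of_set (open_disc k)) (subtopology X (topspace X - Y)) \<Phi>"
    using closed_map_restriction[OF closed_map eq] by simp
  moreover have "continuous_map (top_of_set (open_disc k)) (subtopology X (topspace X - Y)) \<Phi>"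
    using continuous_map_from_subtopology_mono[OF continuous open_disc_subset] cell
    by (auto simp: continuous_map_in_subtopology)
  ultimately show ?thesis
    using inj cell by (intro bijective_closed_imp_homeomorphic_map) (auto simp: Int_absorb1)
qed

section \<open>Deforming a neighborhood of Y into Y\<close>

definition flow :: "real \<times> 'a \<Rightarrow> 'a" where
  "flow = (\<lambda>(t, y). if y \<in> Y then y else \<Phi> (push k t (inv_into (open_disc k) \<Phi> y)))"

lemma flow_fixed: "y \<in> Y \<Longrightarrow> flow (t, y) = y"
  by (simp add: flow_def)

lemma flow_cell: "0 \<le> t \<Longrightarrow> x \<in> disc k \<Longrightarrow> flow (t, \<Phi> x) = \<Phi> (push k t x)"
  by (erule disc_cases) (auto simp: flow_def inv_into_f_f[OF inj] push_boundary)

text \<open>Glued from two closed pieces. Over \<open>Y\<close> the flow is the projection. Over the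
  closed cell, the product of the time interval with \<open>\<Phi>\<close> maps a compact space onto
  a Hausdorff one and is therefore a quotient map, so continuity may be checked on the disc.\<close>

lemma continuous_map_flow: "continuous_map (prod_topology (top_of_set {0..1}) X) X flow"
proof -
  let ?I = "top_of_set {0..1::real}" and ?D = "top_of_set (disc k)"
  let ?q = "\<lambda>(t, x). (t, \<Phi> x)"
  let ?T = "\<lambda>b. if b then {0..1} \<times> Y else {0..1} \<times> \<Phi> ` disc k"
  have closed: "closedin X (\<Phi> ` disc k)"
    using closed_map unfolding closed_map_def
    by (metis closedin_topspace topspace_euclidean_subtopology)
  have q: "quotient_map (prod_topology ?I ?D)
      (subtopology (prod_topology ?I X) ({0..1} \<times> \<Phi> ` disc k)) ?q"
  proof (rule continuous_imp_quotient_map)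
    show "compact_space (prod_topology ?I ?D)"
      using compact_space_disc
      by (subst compact_space_prod_topology) (simp add: compact_space_subtopology)
    show "Hausdorff_space (subtopology (prod_topology ?I X) ({0..1} \<times> \<Phi> ` disc k))"
      using Hausdorff
      by (simp add: Hausdorff_space_subtopology Hausdorff_space_prod_topology)
    show "continuous_map (prod_topology ?I ?D)
      (subtopology (prod_topology ?I X) ({0..1} \<times> \<Phi> ` disc k)) ?q"
    proof -
      have "continuous_map (prod_topology ?I ?D) (prod_topology ?I X) (\<lambda>z. (fst z, (\<Phi> \<circ> snd) z))"
        by (intro continuous_map_pairedI continuous_map_fst
            continuous_map_compose[OF continuous_map_snd continuous])
      then show ?thesis
        unfolding continuous_map_in_subtopology case_prod_unfold comp_def by auto
    qed
    show "?q ` topspace (prod_topology ?I ?D)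
        = topspace (subtopology (prod_topology ?I X) ({0..1} \<times> \<Phi> ` disc k))"
    proof -
      have "?q ` ({0..1} \<times> disc k) = {0..1} \<times> \<Phi> ` disc k"
        by (auto simp: image_iff)
      then show ?thesis
        using topspace_eq by (simp add: Times_Int_Times Int_absorb1)
    qed
  qed
  show ?thesis
  proof (rule pasting_lemma_closed[where I = UNIV and T = ?T and f = "\<lambda>_. flow"])
    show "closedin (prod_topology ?I X) (?T i)" for i
      using closed closedin_Y by (auto simp: closedin_prod_Times_iff)
    show "continuous_map (subtopology (prod_topology ?I X) (?T i)) X flow" for i
    proof (cases i)
      case True
      have "continuous_map (subtopology (prod_topology ?I X) (?T i)) X snd"
        by (intro continuous_map_from_subtopology continuous_map_snd)
      then show ?thesis
        by (rule continuous_map_eq) (use True in \<open>auto simp: flow_fixed\<close>)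
    next
      case False
      have "continuous_map (prod_topology ?I ?D) ?D (\<lambda>(t, x). push k t x)"
        using continuous_on_push[of k]
        by (auto simp: prod_topology_subtopology_eu push_in_disc)
      then have "continuous_map (prod_topology ?I ?D) X (\<Phi> \<circ> (\<lambda>(t, x). push k t x))"
        using continuous by (rule continuous_map_compose)
      then have "continuous_map (prod_topology ?I ?D) X (flow \<circ> ?q)"
        by (rule continuous_map_eq) (auto simp: flow_cell)
      then show ?thesis
        using continuous_compose_quotient_map[OF q] False by simp
    qed
    show "\<exists>j. j \<in> UNIV \<and> z \<in> ?T j \<and> flow z = flow z" if "z \<in> topspace (prod_topology ?I X)" for z
      using that topspace_eq by (cases "snd z \<in> Y") (auto intro: exI[of _ True] exI[of _ False])
  qed simp_all
qed

text \<open>The radius 1/2 is \<open>inverse (1 + t)\<close> at \<open>t = 1\<close>, beyond which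
  the push has reached the boundary.\<close>

definition collar :: "'a set" where
  "collar = topspace X - \<Phi> ` {x \<in> disc k. disc_norm k x \<le> 1/2}"

lemma small_subset: "{x \<in> disc k. disc_norm k x \<le> 1/2} \<subseteq> open_disc k"
  by (auto simp: disc_eq open_disc_eq)

lemma Y_subset_collar: "Y \<subseteq> collar"
  using small_subset cell closedin_subset[OF closedin_Y] by (auto simp: collar_def)

lemma openin_collar: "openin X collar"
proof -
  have "closed {x \<in> disc k. disc_norm k x \<le> 1/2}"
    using closed_disc[of k] closed_Collect_le[OF continuous_on_disc_norm[of UNIV k] continuous_on_const]
    by (simp add: Collect_conj_eq closed_Int del: le_divide_eq_numeral1)
  then have "closedin (top_of_set (disc k)) {x \<in> disc k. disc_norm k x \<le> 1/2}"
    by (simp add: closed_subset)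
  then have "closedin X (\<Phi> ` {x \<in> disc k. disc_norm k x \<le> 1/2})"
    using closed_map by (simp add: closed_map_def)
  then show ?thesis by (simp add: collar_def openin_diff)
qed

text \<open>Identifications on the boundary do not matter: the removed small disc lies in the open
  disc, where \<open>\<Phi>\<close> is injective and avoids \<open>Y\<close>.\<close>

lemma collar_cell: "x \<in> disc k \<Longrightarrow> \<Phi> x \<in> collar \<longleftrightarrow> disc_norm k x > 1/2"
proof -
  assume x: "x \<in> disc k"
  have "x = z" if "\<Phi> x = \<Phi> z" "z \<in> disc k" "disc_norm k z \<le> 1/2" for z
  proof -
    have "z \<in> open_disc k" using that small_subset by blast
    then have "\<Phi> x \<notin> Y" using that cell by auto
    then have "x \<in> open_disc k" using x by (auto elim: disc_cases)
    then show ?thesis using inj that(1) \<open>z \<in> open_disc k\<close> by (auto dest: inj_onD)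
  qed
  then show ?thesis
    using x topspace_eq by (fastforce simp: collar_def not_le)
qed

lemma flow_in_collar: "0 \<le> t \<Longrightarrow> t \<le> 1 \<Longrightarrow> y \<in> collar \<Longrightarrow> flow (t, y) \<in> collar"
proof -
  assume t: "0 \<le> t" "t \<le> 1" and y: "y \<in> collar"
  show ?thesis
  proof (cases "y \<in> Y")
    case False
    then obtain x where x: "x \<in> disc k" "y = \<Phi> x"
      using y topspace_eq by (auto simp: collar_def)
    then have "disc_norm k (push k t x) > 1/2"
      using y collar_cell[of x] disc_norm_push_ge[OF t(1) x(1)] by simp
    then show ?thesis
      using x t collar_cell[OF push_in_disc[OF t(1) x(1)]] by (simp add: flow_cell)
  qed (use y in \<open>simp add: flow_fixed\<close>)
qed

lemma flow_0: "y \<in> topspace X \<Longrightarrow> flow (0, y) = y"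
  using topspace_eq by (auto simp: flow_fixed flow_cell push_0)

lemma flow_1: "y \<in> collar \<Longrightarrow> flow (1, y) \<in> Y"
proof -
  assume y: "y \<in> collar"
  show ?thesis
  proof (cases "y \<in> Y")
    case False
    then obtain x where x: "x \<in> disc k" "y = \<Phi> x"
      using y topspace_eq by (auto simp: collar_def)
    then show ?thesis
      using y collar_cell[of x] push_1[of x k] boundary by (auto simp: flow_cell)
  qed (simp add: flow_fixed)
qed

lemma trivial_relative_homology_group_collar:
  "trivial_group (relative_homology_group p (subtopology X collar) Y)"
proof (rule trivial_relative_homology_group_alt)
  let ?collar = "subtopology X collar"
  have cont: "continuous_map (prod_topology (top_of_set {0..1}) ?collar) ?collar flow"
    using continuous_map_flow flow_in_collar
    by (auto simp: continuous_map_in_subtopology prod_topology_subtopology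
        intro: continuous_map_from_subtopology)
  have "homotopic_with (\<lambda>h. h ` Y \<subseteq> Y) ?collar ?collar id (\<lambda>y. flow (1, y))"
    unfolding homotopic_with_def
  proof (intro exI conjI ballI allI)
    \<comment> \<open>A homotopy must agree with its end maps at every point of the type. The values
      off the collar are chosen only to meet this at times 0 and 1.\<close>
    show "continuous_map (prod_topology (top_of_set {0..1}) ?collar) ?collar
        (\<lambda>(t, y). if y \<in> collar then flow (t, y) else if t = 0 then y else flow (1, y))"
      by (rule continuous_map_eq[OF cont]) auto
  qed (auto simp: flow_fixed flow_0 collar_def dest: subsetD[OF Y_subset_collar])
  then show "homotopic_with (\<lambda>h. h ` Y \<subseteq> Y) ?collar ?collar (\<lambda>y. flow (1, y)) id"
    by (simp add: homotopic_with_sym)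
  have "continuous_map ?collar ?collar (\<lambda>y. flow (1, y))"
    using continuous_map_compose[OF continuous_map_pairedI[OF continuous_map_const[THEN iffD2]
          continuous_map_id] cont, of 1] by (simp add: comp_def)
  then show "continuous_map ?collar (subtopology ?collar Y) (\<lambda>y. flow (1, y))"
    using flow_1 by (auto simp: continuous_map_in_subtopology)
qed

text \<open>The exact sequence of the triple \<open>Y\<close>, \<open>collar\<close>,
  \<open>X\<close> replaces \<open>Y\<close> by the collar. Excising \<open>Y\<close>, which is
  closed inside the open collar, leaves only the open cell, and \<open>\<Phi>\<close> identifies
  that with the open disc. Nothing of the attaching map remains.\<close>

lemma iso_relative_homology_group_open_disc:
  "relative_homology_group p X Y \<cong>
    relative_homology_group p (top_of_set (open_disc k)) {x \<in> open_disc k. disc_norm k x > 1/2}"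
proof -
  have "hom_induced p X Y X collar id
      \<in> iso (relative_homology_group p X Y) (relative_homology_group p X collar)"
    using very_short_exact_sequence
      [of "relative_homology_group (p - 1) (subtopology X collar) Y" "relative_homology_group p X collar"
          "relative_homology_group p X Y" "relative_homology_group p (subtopology X collar) Y"
          "hom_relboundary p X collar Y" "hom_induced p X Y X collar id"
          "hom_induced p (subtopology X collar) Y X Y id"]
      homology_exactness_triple_1[OF Y_subset_collar, of p X]
      homology_exactness_triple_3[OF Y_subset_collar, of p X]
      trivial_relative_homology_group_collar
    by (meson exact_seq_cons_iff)
  then have 1: "relative_homology_group p X Y \<cong> relative_homology_group p X collar"
    by (rule is_isoI)
  have "X closure_of Y \<subseteq> X interior_of collar"
    using closedin_Y openin_collar Y_subset_collar by (simp add: closure_of_closedin interior_of_openin)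
  moreover have "collar \<subseteq> topspace X" by (auto simp: collar_def)
  ultimately have 2: "relative_homology_group p (subtopology X (topspace X - Y)) (collar - Y)
      \<cong> relative_homology_group p X collar"
    using homology_excision_axiom[of X Y collar "topspace X" p] by (auto intro: is_isoI)
  have "\<Phi> ` {x \<in> open_disc k. disc_norm k x > 1/2} = collar - Y"
  proof -
    have "collar - Y \<subseteq> \<Phi> ` open_disc k" using cell by (auto simp: collar_def)
    moreover have "\<Phi> x \<in> collar \<longleftrightarrow> disc_norm k x > 1/2" "\<Phi> x \<notin> Y" if "x \<in> open_disc k" for x
      using that collar_cell subsetD[OF open_disc_subset[of k]] cell by blast+
    ultimately show ?thesis by (auto simp: image_iff subset_iff)
  qed
  then have 3: "relative_homology_group p (top_of_set (open_disc k))
        {x \<in> open_disc k. disc_norm k x > 1/2}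
      \<cong> relative_homology_group p (subtopology X (topspace X - Y)) (collar - Y)"
    by (intro is_isoI[OF homeomorphic_map_relative_homology_iso[OF homeomorphic_map_cell]]) auto
  show ?thesis
    using iso_trans[OF iso_trans[OF 1 group.iso_sym[OF _ 2]] group.iso_sym[OF _ 3]] by simp
qed

end


section \<open>The upper hemisphere as a model of an attached cell\<close>

lemma nsphere_upper_hemisphere:
  "subtopology (nsphere k) {x. x k \<ge> 0} =
    top_of_set {x. (\<Sum>i<k. (x i)\<^sup>2) + (x k)\<^sup>2 = 1 \<and> (\<forall>i>k. x i = 0) \<and> x k \<ge> 0}"
  unfolding nsphere subtopology_subtopology euclidean_product_topology
  by (rule arg_cong[where f = top_of_set]) (auto simp: lessThan_Suc_atMost[symmetric])

text \<open>The hemisphere is the graph of the height function over the disc. Its inverse sets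
  coordinate \<open>k\<close> to 0, and the boundary sphere goes identically to the equator.\<close>

lemma attached_cell_upper_hemisphere:
  "attached_cell (subtopology (nsphere k) {x. x k \<ge> 0})
    (topspace (subtopology (nsphere k) {x. x k \<ge> 0}) \<inter> {x. x k = 0}) k
    (\<lambda>x. x(k := sqrt (1 - (\<Sum>i<k. (x i)\<^sup>2))))"
proof -
  define S where "S = {x. (\<Sum>i<k. (x i)\<^sup>2) + (x k)\<^sup>2 = 1 \<and> (\<forall>i>k. x i = 0) \<and> x k \<ge> (0::real)}"
  define f where "f = (\<lambda>x::nat \<Rightarrow> real. x(k := sqrt (1 - (\<Sum>i<k. (x i)\<^sup>2))))"
  define g where "g = (\<lambda>x::nat \<Rightarrow> real. x(k := 0))"
  have upd: "(\<Sum>i<k. ((x(k := a)) i)\<^sup>2) = (\<Sum>i<k. (x i)\<^sup>2)" for x and a :: real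
    by (rule sum.cong) auto
  have f: "f x \<in> S" if "x \<in> disc k" for x
    using that unfolding disc_def mem_Collect_eq S_def f_def upd by simp
  have fk: "f x k = 0 \<longleftrightarrow> x \<notin> open_disc k" if "x \<in> disc k" for x
    using that unfolding disc_def open_disc_def mem_Collect_eq f_def by auto
  have gf: "g (f x) = x" if "x \<in> disc k" for x
    using that unfolding disc_def f_def g_def by (simp add: fun_upd_idem)
  have fg: "g y \<in> disc k" "f (g y) = y" if "y \<in> S" for y
  proof -
    have y: "(\<Sum>i<k. (y i)\<^sup>2) + (y k)\<^sup>2 = 1" "\<And>i. i > k \<Longrightarrow> y i = 0" "y k \<ge> 0"
      using that by (simp_all add: S_def)
    then have "(\<Sum>i<k. (y i)\<^sup>2) \<le> 1"
      using zero_le_power2[of "y k"] by linarith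
    then show "g y \<in> disc k"
      using y(2) unfolding disc_def mem_Collect_eq g_def upd by simp
    have "1 - (\<Sum>i<k. (y i)\<^sup>2) = (y k)\<^sup>2"
      using y(1) by linarith
    then show "f (g y) = y"
      using y(3) unfolding f_def g_def upd by simp
  qed
  have "continuous_on (disc k) (\<lambda>x. f x i)" for i
    unfolding f_def
    by (cases "i = k")
       (auto intro!: continuous_intros continuous_on_subset[OF continuous_on_product_coordinates])
  then have "continuous_on (disc k) f"
    by (rule continuous_on_coordinatewise_then_product)
  moreover have "closedin (top_of_set S) (S \<inter> {x. x k = 0})"
    by (intro closedin_closed_Int closed_Collect_eq continuous_on_product_coordinates continuous_on_const)
  moreover have "inj_on f (open_disc k)"
    using gf subsetD[OF open_disc_subset] by (metis inj_on_inverseI)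
  moreover have "f ` open_disc k = S - S \<inter> {x. x k = 0}"
  proof
    show "f ` open_disc k \<subseteq> S - S \<inter> {x. x k = 0}"
      using f fk subsetD[OF open_disc_subset[of k]] by blast
    show "S - S \<inter> {x. x k = 0} \<subseteq> f ` open_disc k"
    proof
      fix y assume y: "y \<in> S - S \<inter> {x. x k = 0}"
      then have "g y \<in> open_disc k"
        using fk[of "g y"] fg[of y] by auto
      then show "y \<in> f ` open_disc k"
        using y fg(2)[of y] by (metis DiffD1 image_eqI)
    qed
  qed
  moreover have "f ` (disc k - open_disc k) \<subseteq> S \<inter> {x. x k = 0}"
    using f fk by blast
  moreover have "f ` disc k \<subseteq> S"
    using f by blast
  ultimately have "attached_cell (top_of_set S) (S \<inter> {x. x k = 0}) k f"
    by unfold_locales (simp_all add: Hausdorff_space_subtopology image_subset_iff_funcset)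
  then show ?thesis
    unfolding nsphere_upper_hemisphere S_def f_def by simp
qed

text \<open>The given pair and the hemisphere with its equator have the relative homology of the
  same disc pair. For the hemisphere this equals the homology of the sphere relative to the lower
  hemisphere, hence the reduced homology of the sphere.\<close>

lemma (in attached_cell) isomorphic_relative_homology_group_nsphere:
  "relative_homology_group p X Y \<cong> reduced_homology_group p (nsphere k)"
proof -
  let ?U = "subtopology (nsphere k) {x. x k \<ge> 0}"
  have "relative_homology_group p X Y \<cong> relative_homology_group p ?U (topspace ?U \<inter> {x. x k = 0})"
    by (rule iso_trans[OF iso_relative_homology_group_open_disc group.iso_sym[OF _
            attached_cell.iso_relative_homology_group_open_disc[OF attached_cell_upper_hemisphere]]])
       simp
  also have "relative_homology_group p ?U (topspace ?U \<inter> {x. x k = 0})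
      = relative_homology_group p ?U {x. x k = 0}"
    by (rule relative_homology_group_restrict)
  finally have "relative_homology_group p X Y \<cong> relative_homology_group p (nsphere k) {x. x k \<le> 0}"
    using iso_relative_homology_group_upper_hemisphere is_isoI iso_trans by blast
  moreover have "reduced_homology_group p (nsphere k)
      \<cong> relative_homology_group p (nsphere k) {x. x k \<le> 0}"
    using iso_reduced_homology_group_lower_hemisphere is_isoI by blast
  ultimately show ?thesis
    using group.iso_sym iso_trans by (metis group_reduced_homology_group)
qed

section \<open>Finite cell complexes\<close>

definition cell_union :: "'c set \<Rightarrow> ('c \<Rightarrow> nat) \<Rightarrow> ('c \<Rightarrow> (nat \<Rightarrow> real) \<Rightarrow> 'a) \<Rightarrow> 'a set" where
  "cell_union C d \<Phi> = (\<Union>c\<in>C. \<Phi> c ` open_disc (d c))"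

text \<open>Cell boundaries lie in cells of strictly smaller dimension, so none meets an open cell
  of maximal dimension; removing that cell leaves a complex.\<close>

lemma top_cell:
  assumes X: "cell_structure X C d \<Phi>" and c: "c \<in> C" and max: "\<And>c'. c' \<in> C \<Longrightarrow> d c' \<le> d c"
  defines "Y \<equiv> cell_union (C - {c}) d \<Phi>"
  shows "attached_cell X Y (d c) (\<Phi> c)" "cell_structure (subtopology X Y) (C - {c}) d \<Phi>"
proof -
  have fin: "finite C" and Haus: "Hausdorff_space X" and top: "topspace X = cell_union C d \<Phi>"
    using X unfolding cell_structure_def cell_union_def by blast+
  have inj: "inj_on (\<Phi> a) (open_disc (d a))" if "a \<in> C" for a
    using X that unfolding cell_structure_def by simp
  have disj: "\<Phi> a ` open_disc (d a) \<inter> \<Phi> b ` open_disc (d b) = {}"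
    if "a \<in> C" "b \<in> C" "a \<noteq> b" for a b
    using X that unfolding cell_structure_def by simp
  have bd: "\<Phi> a ` (disc (d a) - open_disc (d a)) \<subseteq> cell_union {b\<in>C. d b < d a} d \<Phi>"
    if "a \<in> C" for a
    using X that unfolding cell_structure_def cell_union_def by simp
  have cont: "continuous_map (top_of_set (disc (d a))) X (\<Phi> a)" if "a \<in> C" for a
  proof -
    have "continuous_map (subtopology (Euclidean_space (d a)) (disc (d a))) X (\<Phi> a)"
      using X that unfolding cell_structure_def by simp
    then show ?thesis by (simp add: subtopology_Euclidean_disc)
  qed
  have low: "cell_union {c'\<in>C. d c' < d a} d \<Phi> \<subseteq> Y" if "a \<in> C" for a
    using max[OF that] by (force simp: cell_union_def Y_def)
  \<comment> \<open>Open discs may be replaced by closed ones because the boundaries lie in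
    \<open>Y\<close> anyway. As a finite union of compact images, \<open>Y\<close> is then
    closed.\<close>
  have YU: "Y = (\<Union>a\<in>C - {c}. \<Phi> a ` disc (d a))"
  proof
    show "Y \<subseteq> (\<Union>a\<in>C - {c}. \<Phi> a ` disc (d a))"
      unfolding Y_def cell_union_def by (intro UN_mono image_mono open_disc_subset order_refl)
    have "\<Phi> a ` disc (d a) \<subseteq> Y" if a: "a \<in> C - {c}" for a
    proof -
      have "\<Phi> a ` open_disc (d a) \<subseteq> Y"
        using a by (auto simp: Y_def cell_union_def)
      moreover have "\<Phi> a ` (disc (d a) - open_disc (d a)) \<subseteq> Y"
        using bd[of a] low[of a] a by blast
      ultimately show ?thesis by blast
    qed
    then show "(\<Union>a\<in>C - {c}. \<Phi> a ` disc (d a)) \<subseteq> Y" by blast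
  qed
  have closed: "closedin X Y"
    unfolding YU
  proof (rule closedin_Union)
    show "finite ((\<lambda>a. \<Phi> a ` disc (d a)) ` (C - {c}))"
      using fin by simp
    show "closedin X S" if "S \<in> (\<lambda>a. \<Phi> a ` disc (d a)) ` (C - {c})" for S
    proof -
      from that obtain a where a: "a \<in> C" "S = \<Phi> a ` disc (d a)" by blast
      have "compactin (top_of_set (disc (d a))) (disc (d a))"
        using compact_disc by (simp add: compactin_subtopology)
      then show ?thesis
        using a cont[OF a(1)] Haus by (metis compactin_imp_closedin image_compactin)
    qed
  qed
  have "topspace X = \<Phi> c ` open_disc (d c) \<union> Y"
    using top c by (auto simp: cell_union_def Y_def)
  moreover have "\<Phi> c ` open_disc (d c) \<inter> Y = {}"
    using disj c by (fastforce simp: cell_union_def Y_def)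
  ultimately have "\<Phi> c ` open_disc (d c) = topspace X - Y"
    by blast
  moreover have "\<Phi> c ` (disc (d c) - open_disc (d c)) \<subseteq> Y"
    using bd[OF c] low[OF c] by blast
  ultimately show "attached_cell X Y (d c) (\<Phi> c)"
    using Haus closed cont[OF c] inj[OF c] by unfold_locales
  show "cell_structure (subtopology X Y) (C - {c}) d \<Phi>"
    unfolding cell_structure_def
  proof (intro conjI ballI impI)
    show "continuous_map (subtopology (Euclidean_space (d a)) (disc (d a))) (subtopology X Y) (\<Phi> a)"
      if "a \<in> C - {c}" for a
      using cont[of a] that YU subtopology_Euclidean_disc[of "disc (d a)" "d a"]
      by (auto simp: continuous_map_in_subtopology)
    show "\<Phi> a ` (disc (d a) - open_disc (d a))
        \<subseteq> (\<Union>c'\<in>{c' \<in> C - {c}. d c' < d a}. \<Phi> c' ` open_disc (d c'))" if a: "a \<in> C - {c}" for a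
    proof -
      have "{c' \<in> C - {c}. d c' < d a} = {c' \<in> C. d c' < d a}"
        using max[of a] a by auto
      then show ?thesis using bd[of a] a by (simp add: cell_union_def)
    qed
    show "topspace (subtopology X Y) = (\<Union>c\<in>C - {c}. \<Phi> c ` open_disc (d c))"
      using closedin_subset[OF closed] by (auto simp: Y_def cell_union_def)
  qed (use fin Haus inj disj in \<open>auto simp: Hausdorff_space_subtopology\<close>)
qed

text \<open>Cells above dimension \<open>p\<close> are removed one at a time, largest dimension
  first. The relative homology of each removal sits in a degree at least \<open>p + 2\<close>; it
  vanishes in degrees \<open>p\<close> and \<open>p + 1\<close>, and exactness makes the inclusion
  an isomorphism in degree \<open>p\<close>.\<close>

lemma reduced_homology_group_skeleton:
  assumes "cell_structure X C d \<Phi>" and "\<And>c. c \<in> C \<Longrightarrow> d c \<le> p \<or> p + 2 \<le> d c"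
  defines "C0 \<equiv> {c\<in>C. d c \<le> p}"
  defines "X0 \<equiv> subtopology X (cell_union C0 d \<Phi>)"
  shows "cell_structure X0 C0 d \<Phi> \<and>
    reduced_homology_group (int p) X \<cong> reduced_homology_group (int p) X0"
  unfolding X0_def C0_def
  using assms(1,2)
proof (induction "card {c\<in>C. p < d c}" arbitrary: X C)
  case 0
  then have "finite C" by (simp add: cell_structure_def)
  with 0 have "{c\<in>C. d c \<le> p} = C" by (auto simp: not_le)
  moreover have "subtopology X (cell_union C d \<Phi>) = X"
    using 0(2) subtopology_topspace[of X] by (simp add: cell_structure_def cell_union_def)
  ultimately show ?case
    using 0 by (simp add: iso_refl)
next
  case (Suc i)
  have fin: "finite C" using Suc.prems by (simp add: cell_structure_def)
  obtain b where b: "b \<in> C" "p < d b"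
    using Suc.hyps(2) by (metis (mono_tags, lifting) card.empty Collect_empty_eq nat.distinct(1))
  then have "Max (d ` C) \<in> d ` C"
    using fin by (intro Max_in) auto
  then obtain c where c: "c \<in> C" "d c = Max (d ` C)" by auto
  then have max: "d c' \<le> d c" if "c' \<in> C" for c'
    using fin that by simp
  then have k: "p + 2 \<le> d c"
    using Suc.prems(2)[OF c(1)] max[OF b(1)] b(2) by linarith
  let ?Y = "cell_union (C - {c}) d \<Phi>"
  let ?C0 = "{c\<in>C. d c \<le> p}"
  interpret attached_cell X ?Y "d c" "\<Phi> c"
    using top_cell(1)[OF Suc.prems(1) c(1) max] .
  have C0: "{a\<in>C - {c}. d a \<le> p} = ?C0"
    using k by auto
  have "{a\<in>C. p < d a} = insert c {a\<in>C - {c}. p < d a}"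
    using c k by auto
  then have "i = card {a\<in>C - {c}. p < d a}"
    using Suc.hyps(2) fin by simp
  from Suc.hyps(1)[OF this top_cell(2)[OF Suc.prems(1) c(1) max]] Suc.prems(2)
  have IH: "cell_structure (subtopology (subtopology X ?Y) (cell_union ?C0 d \<Phi>)) ?C0 d \<Phi> \<and>
    reduced_homology_group (int p) (subtopology X ?Y)
      \<cong> reduced_homology_group (int p) (subtopology (subtopology X ?Y) (cell_union ?C0 d \<Phi>))"
    unfolding C0 by blast
  have "cell_union ?C0 d \<Phi> \<subseteq> ?Y"
    using k by (auto simp: cell_union_def)
  then have eq: "subtopology (subtopology X ?Y) (cell_union ?C0 d \<Phi>)
      = subtopology X (cell_union ?C0 d \<Phi>)"
    by (simp add: subtopology_subtopology Int_absorb1)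
  have triv: "trivial_group (relative_homology_group q X ?Y)" if "q \<noteq> int (d c)" for q
    using isomorphic_group_triviality[OF isomorphic_relative_homology_group_nsphere]
      reduced_homology_group_nsphere(2)[OF that] by simp
  have "hom_induced (int p) (subtopology X ?Y) {} X {} id
      \<in> iso (reduced_homology_group (int p) (subtopology X ?Y)) (reduced_homology_group (int p) X)"
    using very_short_exact_sequence
      [of "relative_homology_group (int p) X ?Y" "reduced_homology_group (int p) X"
          "reduced_homology_group (int p) (subtopology X ?Y)"
          "relative_homology_group (int p + 1) X ?Y"
          "hom_induced (int p) X {} X ?Y id"
          "hom_induced (int p) (subtopology X ?Y) {} X {} id"
          "hom_boundary (int p + 1) X ?Y"]
      homology_exactness_reduced_2[of "int p + 1" X ?Y]
      homology_exactness_reduced_3[of "int p" X ?Y]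
      triv[of "int p"] triv[of "int p + 1"] k
    by (simp add: exact_seq_cons_iff)
  then have "reduced_homology_group (int p) X \<cong> reduced_homology_group (int p) (subtopology X ?Y)"
    by (intro group.iso_sym[OF _ is_isoI]) auto
  then show ?case
    using IH iso_trans unfolding eq by blast
qed

lemma open_disc_0: "open_disc 0 = {\<lambda>_. 0}"
  by (auto simp: open_disc_def)

lemma trivial_reduced_homology_group_one_cell:
  assumes "cell_structure X {c} d \<Phi>" "d c = 0"
  shows "trivial_group (reduced_homology_group p X)"
proof (rule homology_dimension_reduced)
  show "topspace X = {\<Phi> c (\<lambda>_. 0)}"
    using assms by (simp add: cell_structure_def open_disc_0)
qed

text \<open>Removing the \<open>p\<close>-cell leaves a point, relative to which homology is reduced
  homology. No homeomorphism with a sphere has to be constructed.\<close>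

lemma reduced_homology_group_sphere_like:
  assumes X: "cell_structure X {c, c'} d \<Phi>" and d: "d c = 0" "d c' = p" "p > 0"
  shows "reduced_homology_group (int p) X \<cong> integer_group"
proof -
  have ne: "c \<noteq> c'" using d by auto
  have max: "d a \<le> d c'" if "a \<in> {c, c'}" for a
    using that d by auto
  have eq: "{c, c'} - {c'} = {c}" using ne by auto
  let ?Y = "cell_union {c} d \<Phi>"
  interpret attached_cell X ?Y p "\<Phi> c'"
    using top_cell(1)[OF X _ max] unfolding eq d(2) by simp
  have Y: "?Y = {\<Phi> c (\<lambda>_. 0)}"
    using d by (simp add: cell_union_def open_disc_0)
  then have "\<Phi> c (\<lambda>_. 0) \<in> topspace X"
    using closedin_subset[OF closedin_Y] by simp
  then have "reduced_homology_group (int p) X \<cong> relative_homology_group (int p) X ?Y"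
    using isomorphic_reduced_homology_by_singleton Y by metis
  also have "\<dots> \<cong> reduced_homology_group (int p) (nsphere p)"
    by (rule isomorphic_relative_homology_group_nsphere)
  also have "\<dots> \<cong> integer_group"
    by (rule reduced_homology_group_nsphere(1))
  finally show ?thesis .
qed

section \<open>The homology of \<open>X\<^sup>m\<^sub>n\<close>\<close>

theorem theorem5p4:
  fixes m n :: nat and d :: int and X :: "'a topology"
  assumes "m \<ge> 4"
    and "d = \<lfloor>(2 * real n + 2) / 3\<rfloor>"
    and "is_X m n X"
  shows "((\<exists>k::nat. n = 3 * k \<or> n = 3 * k + 1) \<longrightarrow>
            reduced_homology_group d X \<cong> integer_group) \<and>
         ((\<exists>k::nat. n = 3 * k + 2) \<longrightarrow>
            trivial_group (reduced_homology_group d X))"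
proof -
  define D where "D = (2 * n + 2) div 3"
  have d: "d = int D"
    using assms(2) floor_divide_of_nat_eq[of "2 * n + 2" 3, where ?'a = real]
    by (simp add: D_def add.commute)
  have "n mod 3 \<noteq> 2 \<Longrightarrow> reduced_homology_group d X \<cong> integer_group"
    and "n mod 3 = 2 \<Longrightarrow> trivial_group (reduced_homology_group d X)"
  proof (atomize (full), cases "n = 0")
    case True
    then have "reduced_homology_group d X \<cong> reduced_homology_group (int 0) (nsphere 0)"
      using assms(3) d
      by (simp add: is_X_def D_def homeomorphic_space_imp_isomorphic_reduced_homology_groups)
    then show "(n mod 3 \<noteq> 2 \<longrightarrow> reduced_homology_group d X \<cong> integer_group) \<and>
      (n mod 3 = 2 \<longrightarrow> trivial_group (reduced_homology_group d X))"
      using True iso_trans[OF _ reduced_homology_group_nsphere(1)[of 0]] by simp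
  next
    case False
    define C where "C = critical_cells (Delta m n) {} {} (comb_tree m n)"
    have "morse_complex (Delta m n) (comb_tree m n) X"
      using False assms(3) by (simp add: is_X_def)
    then obtain \<Phi> where T: "matching_tree (Delta m n) {} {} (comb_tree m n)"
      and X: "cell_structure X (insert None (Some ` C)) cell_dim \<Phi>"
      unfolding morse_complex_def C_def by blast
    \<comment> \<open>Keeps the base 0-cell and a cell of dimension \<open>D\<close> in different
      dimensions.\<close>
    have D: "D > 0" using False by (simp add: D_def)
    let ?C = "insert None (Some ` C)"
    let ?L = "{c \<in> ?C. cell_dim c \<le> D}"
    have skeleton: "cell_structure (subtopology X (cell_union ?L cell_dim \<Phi>)) ?L cell_dim \<Phi>"
        "reduced_homology_group d X
          \<cong> reduced_homology_group d (subtopology X (cell_union ?L cell_dim \<Phi>))"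
      if dims: "\<And>A. A \<in> C \<Longrightarrow> card A = D + 1 \<or> D + 3 \<le> card A"
    proof -
      have dim: "cell_dim c \<le> D \<or> D + 2 \<le> cell_dim c" if c: "c \<in> ?C" for c
      proof (cases c)
        case (Some A)
        then have "A \<in> C" using c by blast
        then have "card A = D + 1 \<or> D + 3 \<le> card A" by (rule dims)
        moreover have "cell_dim c = card A - 1" using Some by simp
        ultimately show ?thesis by linarith
      qed simp
      have *: "cell_structure (subtopology X (cell_union ?L cell_dim \<Phi>)) ?L cell_dim \<Phi> \<and>
        reduced_homology_group (int D) X
          \<cong> reduced_homology_group (int D) (subtopology X (cell_union ?L cell_dim \<Phi>))"
        by (rule reduced_homology_group_skeleton[OF X dim])
      show "cell_structure (subtopology X (cell_union ?L cell_dim \<Phi>)) ?L cell_dim \<Phi>"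
        using * by (rule conjunct1)
      show "reduced_homology_group d X
          \<cong> reduced_homology_group d (subtopology X (cell_union ?L cell_dim \<Phi>))"
        unfolding d using * by (rule conjunct2)
    qed
    note cells = critical_cells_comb_tree[OF assms(1) T, folded C_def D_def]
    show "(n mod 3 \<noteq> 2 \<longrightarrow> reduced_homology_group d X \<cong> integer_group) \<and>
      (n mod 3 = 2 \<longrightarrow> trivial_group (reduced_homology_group d X))"
    proof (rule cells)
      assume 1: "n mod 3 = 2" "\<And>A. A \<in> C \<Longrightarrow> D + 3 \<le> card A"
      have dims: "card B = D + 1 \<or> D + 3 \<le> card B" if "B \<in> C" for B
        using 1(2)[OF that] by simp
      \<comment> \<open>The truncated subtraction in \<open>cell_dim\<close> is harmless, since the
        bound on \<open>card B\<close> also excludes the empty face.\<close>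
      have "cell_dim (Some B) > D" if "B \<in> C" for B
        using 1(2)[OF that] by simp
      then have "?L = {None}"
        by (auto simp del: cell_dim.simps(2) dest: leD)
      then have "cell_structure (subtopology X (cell_union ?L cell_dim \<Phi>)) {None} cell_dim \<Phi>"
        using skeleton(1)[OF dims] by simp
      then have "trivial_group
          (reduced_homology_group d (subtopology X (cell_union ?L cell_dim \<Phi>)))"
        by (rule trivial_reduced_homology_group_one_cell) simp
      then show ?thesis
        using 1(1) isomorphic_group_triviality[OF skeleton(2)[OF dims]] by simp
    next
      fix A
      assume 2: "n mod 3 \<noteq> 2" "A \<in> C" "card A = D + 1"
        "\<And>B. B \<in> C \<Longrightarrow> B \<noteq> A \<Longrightarrow> D + 3 \<le> card B"
      have dims: "card B = D + 1 \<or> D + 3 \<le> card B" if "B \<in> C" for B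
        using 2 that by (cases "B = A") auto
      have "cell_dim (Some B) > D" if "B \<in> C" "B \<noteq> A" for B
        using 2(4)[OF that] by simp
      moreover have "cell_dim (Some A) = D"
        using 2(3) by simp
      ultimately have "?L = {None, Some A}"
        using 2(2) by (auto simp del: cell_dim.simps(2) dest: leD)
      then have "cell_structure (subtopology X (cell_union ?L cell_dim \<Phi>)) {None, Some A} cell_dim \<Phi>"
        using skeleton(1)[OF dims] by simp
      then have "reduced_homology_group d (subtopology X (cell_union ?L cell_dim \<Phi>))
          \<cong> integer_group"
        unfolding d by (rule reduced_homology_group_sphere_like) (use 2(3) D in simp_all)
      then show ?thesis
        using 2(1) iso_trans[OF skeleton(2)[OF dims]] by simp
    qed
  qed
  then show ?thesis by (auto simp: div_mod_3)
qed

end
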